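(* Let $Q=(Q_0,Q_1)$ be a connected acyclic quiver such that $(Q,\delta_Q)$ is tight. Let $T$ be a spanning tree of $Q$, let $Q_1\setminus T_1=\{b_1,\dots,b_d\}$ (so $d=|Q_1|-|Q_0|+1$), and let $f_{b_1},\dots,f_{b_d}$ be the associated circulations. Identify $\ker(\mathrm{inc})\subseteq\mathbb{R}^{Q_1}$ with $\mathbb{R}^d$ via $\sum_j x_jf_{b_j}\leftrightarrow (x_1,\dots,x_d)$, and let $P^{\Delta}(Q,\delta_Q)=\{c\in\mathbb{R}^d: c\cdot x\le 1\ \forall x\in P(Q,\delta_Q)-\mathbf{1}\}$. Then $$P^{\Delta}(Q,\delta_Q)=\mathrm{conv}\left\{\big(-f_{b_1}(a),-f_{b_2}(a),\dots,-f_{b_d}(a)\big)^{\top}: a\in Q_1\right\},$$ and each of the points $\big(-f_{b_1}(a),\dots,-f_{b_d}(a)\big)^{\top}$, $a\in Q_1$, is a vertex of $P^{\Delta}(Q,\delta_Q)$.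
   Context: Quiver: finite directed multigraph, arrow $a$ has tail $a^-$, head $a^+$. $\mathrm{inc}:\mathbb{R}^{Q_1}\to\mathbb{R}^{Q_0}$, $\mathrm{inc}(f)_i=\sum_{a^+=i}f(a)-\sum_{a^-=i}f(a)$; $\delta_Q=\mathrm{inc}(\mathbf{1})$. Flow polytope $P(Q,\theta)=\{x\in\mathbb{R}^{Q_1}: x\ge 0,\ \mathrm{inc}(x)=\theta\}$. Subquiver $Q'$: same vertices, arrow subset $Q'_1$. $V\subseteq Q_0$ is $Q'$-successor closed if no arrow of $Q'_1$ has tail in $V$ and head outside $V$. $Q'$ is $\theta$-stable if $\sum_{i\in V}\theta(i)>0$ for every nonempty proper $Q'$-successor closed $V$. $(Q,\theta)$ is tight if for every $a\in Q_1$ the subquiver with arrow set $Q_1\setminus\{a\}$ is $\theta$-stable. For a spanning tree $T=(Q_0,T_1)$ and $b\in Q_1\setminus T_1$, let $c_b$ be the unique cycle in the undirected graph $T\cup\{b\}$, traversed in the direction of $b$; the circulation $f_b\in\mathbb{Z}^{Q_1}$ is $f_b(a)=1$ if $a$ lies on $c_b$ and is traversed along its orientation, $-1$ if traversed against its orientation, and $0$ otherwise. The $f_{b_j}$ form a basis of $\ker(\mathrm{inc})\cap\mathbb{Z}^{Q_1}$. *)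

theory Defs
  imports "HOL-Analysis.Analysis" "Graph_Theory.Digraph_Component"
begin

text \<open>
  A quiver is a finite directed multigraph, i.e. a \<^locale>\<open>fin_digraph\<close>; the tail and head of an
  arrow are \<^const>\<open>tail\<close> and \<^const>\<open>head\<close>. A vector indexed by the arrows of \<open>Q\<close> is a function on
  the arrow type that vanishes off \<^term>\<open>arcs Q\<close>; in particular the all-ones vector is
  \<^term>\<open>indicator (arcs Q)\<close>.
\<close>

definition incidence :: "('v, 'e) pre_digraph \<Rightarrow> ('e \<Rightarrow> real) \<Rightarrow> 'v \<Rightarrow> real" where
  "incidence Q x i = (\<Sum>a\<in>in_arcs Q i. x a) - (\<Sum>a\<in>out_arcs Q i. x a)"

definition canonical_weight :: "('v, 'e) pre_digraph \<Rightarrow> 'v \<Rightarrow> real" where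
  "canonical_weight Q = incidence Q (indicator (arcs Q))"

definition flow_polytope :: "('v, 'e) pre_digraph \<Rightarrow> ('v \<Rightarrow> real) \<Rightarrow> ('e \<Rightarrow> real) set" where
  "flow_polytope Q \<theta> = {x. (\<forall>a. a \<notin> arcs Q \<longrightarrow> x a = 0) \<and> (\<forall>a\<in>arcs Q. 0 \<le> x a) \<and>
     (\<forall>i\<in>verts Q. incidence Q x i = \<theta> i)}"

definition successor_closed :: "('v, 'e) pre_digraph \<Rightarrow> 'v set \<Rightarrow> bool" where
  "successor_closed Q V \<longleftrightarrow>
     V \<subseteq> verts Q \<and> \<not> (\<exists>a\<in>arcs Q. tail Q a \<in> V \<and> head Q a \<notin> V)"

definition stable :: "('v, 'e) pre_digraph \<Rightarrow> ('v \<Rightarrow> real) \<Rightarrow> bool" where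
  "stable Q \<theta> \<longleftrightarrow>
     (\<forall>V. V \<noteq> {} \<and> V \<noteq> verts Q \<and> successor_closed Q V \<longrightarrow> 0 < (\<Sum>i\<in>V. \<theta> i))"

definition tight :: "('v, 'e) pre_digraph \<Rightarrow> ('v \<Rightarrow> real) \<Rightarrow> bool" where
  "tight Q \<theta> \<longleftrightarrow> (\<forall>a\<in>arcs Q. stable (pre_digraph.del_arc Q a) \<theta>)"

text \<open>
  The underlying undirected multigraph, with each arrow \<open>a\<close> replaced by its two traversals:
  \<open>(a, True)\<close> along the orientation of \<open>a\<close> and \<open>(a, False)\<close> against it.
\<close>

definition traversals :: "('v, 'e) pre_digraph \<Rightarrow> ('v, 'e \<times> bool) pre_digraph" where
  "traversals Q = \<lparr> verts = verts Q, arcs = arcs Q \<times> UNIV,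
     tail = (\<lambda>(a, s). if s then tail Q a else head Q a),
     head = (\<lambda>(a, s). if s then head Q a else tail Q a) \<rparr>"

text \<open>
  Distinctness of the underlying arrows is needed to exclude going back and forth along a single
  arrow; two parallel arrows do form an undirected cycle.
\<close>

definition undirected_cycle :: "('v, 'e) pre_digraph \<Rightarrow> ('e \<times> bool) list \<Rightarrow> bool" where
  "undirected_cycle Q p \<longleftrightarrow> pre_digraph.cycle (traversals Q) p \<and> distinct (map fst p)"

text \<open>
  The library notion \<^const>\<open>spanning_tree\<close> forbids directed cycles only (it is meant for symmetric
  digraphs), so it is not the right notion for a quiver.
\<close>

definition quiver_spanning_tree :: "('v, 'e) pre_digraph \<Rightarrow> ('v, 'e) pre_digraph \<Rightarrow> bool" where
  "quiver_spanning_tree T Q \<longleftrightarrow>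
     spanning T Q \<and> Digraph_Component.connected T \<and> \<not> (\<exists>p. undirected_cycle T p)"

text \<open>
  Starting the cycle with the forward traversal of \<open>b\<close> fixes both its direction and its base point,
  which makes the list representing it unique.
\<close>

definition fundamental_cycle :: "('v, 'e) pre_digraph \<Rightarrow> 'e \<Rightarrow> ('e \<times> bool) list" where
  "fundamental_cycle T b =
     (THE p. undirected_cycle (pre_digraph.add_arc T b) p \<and> hd p = (b, True))"

definition circulation :: "('v, 'e) pre_digraph \<Rightarrow> 'e \<Rightarrow> 'e \<Rightarrow> int" where
  "circulation T b a =
     (if (a, True) \<in> set (fundamental_cycle T b) then 1
      else if (a, False) \<in> set (fundamental_cycle T b) then -1
      else 0)"

text \<open>
  An enumeration \<open>b\<close> of the arrows outside \<open>T\<close> identifies \<open>real ^ 'd\<close> with the kernel of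
  \<^const>\<open>incidence\<close> via \<open>circulation_combination\<close>; \<open>polar_dual\<close> is the polar, in these
  coordinates, of the flow polytope translated by minus the all-ones vector.
\<close>

definition circulation_combination ::
    "('v, 'e) pre_digraph \<Rightarrow> ('d::finite \<Rightarrow> 'e) \<Rightarrow> real ^ 'd \<Rightarrow> 'e \<Rightarrow> real" where
  "circulation_combination T b x = (\<lambda>a. \<Sum>j\<in>UNIV. x $ j * real_of_int (circulation T (b j) a))"

definition shifted_flow_polytope :: "('v, 'e) pre_digraph \<Rightarrow> ('v \<Rightarrow> real) \<Rightarrow> ('e \<Rightarrow> real) set" where
  "shifted_flow_polytope Q \<theta> = (\<lambda>y a. y a - indicator (arcs Q) a) ` flow_polytope Q \<theta>"

definition polar_dual ::
    "('v, 'e) pre_digraph \<Rightarrow> ('v \<Rightarrow> real) \<Rightarrow> ('v, 'e) pre_digraph \<Rightarrow> ('d::finite \<Rightarrow> 'e) \<Rightarrow>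
     (real ^ 'd) set" where
  "polar_dual Q \<theta> T b =
     {c. \<forall>x. circulation_combination T b x \<in> shifted_flow_polytope Q \<theta> \<longrightarrow> c \<bullet> x \<le> 1}"

definition dual_point :: "('v, 'e) pre_digraph \<Rightarrow> ('d::finite \<Rightarrow> 'e) \<Rightarrow> 'e \<Rightarrow> real ^ 'd" where
  "dual_point T b a = (\<chi> j. - real_of_int (circulation T (b j) a))"

end

theory Submission
  imports Defs
begin

text \<open>
  Vectors on arrows orthogonal to all fundamental circulations are exactly the potential differences
  \<open>a \<mapsto> y (head a) - y (tail a)\<close>. Thus linear relations among the dual points are given by potentials.
  Since \<open>Q\<close> is acyclic, a height function yields a relation with positive coefficients, so \<open>0\<close> lies in
  the convex hull of the dual points and the polar of the polytope they cut out is that hull. If the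
  dual point of \<open>a\<close> were a convex combination of others, the corresponding potential \<open>y\<close> would increase
  weakly along every arrow except \<open>a\<close>, and strictly decrease along \<open>a\<close>; its superlevel sets would be
  successor closed in \<open>Q\<close> without \<open>a\<close>, so stability would force \<open>\<Sum>v. y v * canonical_weight Q v\<close>, which
  is the sum of the coefficients of the relation, to be positive rather than \<open>0\<close>.
\<close>

section \<open>Potentials and undirected cycles\<close>

text \<open>The clauses of \<open>circulation\<close> for an arbitrary list, so that cycles can be
  compared before \<open>fundamental_cycle\<close> is known to be well defined.\<close>

definition traversal_count :: "('e \<times> bool) list \<Rightarrow> 'e \<Rightarrow> int" where
  "traversal_count p a = (if (a, True) \<in> set p then 1 else if (a, False) \<in> set p then -1 else 0)"

lemma circulation_eq: "circulation T b = traversal_count (fundamental_cycle T b)"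
  by (simp add: fun_eq_iff circulation_def traversal_count_def)

text \<open>Since no arrow repeats in \<open>p\<close>, each entry accounts for exactly one nonzero
  coefficient.\<close>

lemma sum_traversal_count:
  fixes w :: "'e \<Rightarrow> real"
  assumes "distinct (map fst p)" "fst ` set p \<subseteq> A" "finite A"
  shows "(\<Sum>a\<in>A. w a * traversal_count p a) = (\<Sum>(a, s)\<leftarrow>p. if s then w a else - w a)"
  using assms
proof (induction p)
  case Nil
  then show ?case by (simp add: traversal_count_def)
next
  case (Cons x p)
  obtain a s where x: "x = (a, s)" by (cases x)
  have a: "a \<in> A" "\<And>s. (a, s) \<notin> set p"
    using Cons.prems by (auto simp: x rev_image_eqI)
  have "w c * traversal_count (x # p) c =
      w c * traversal_count p c + (if c = a then (if s then w a else - w a) else 0)" for c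
    using a(2) by (auto simp: x traversal_count_def)
  then show ?case
    using Cons a(1) by (simp add: x sum.distrib)
qed

section \<open>Undirected walks as walks of traversals\<close>

lemma traversals_simps [simp]:
  "verts (traversals G) = verts G"
  "arcs (traversals G) = arcs G \<times> UNIV"
  "tail (traversals G) (a, s) = (if s then tail G a else head G a)"
  "head (traversals G) (a, s) = (if s then head G a else tail G a)"
  by (simp_all add: traversals_def)

lemma wf_digraph_traversals: "wf_digraph G \<Longrightarrow> wf_digraph (traversals G)"
  by (auto simp: wf_digraph_def)

text \<open>\<open>cas\<close> looks only at tails and heads, never at the arc set. This moves walks
  between a graph and its extension by further arrows.\<close>

lemma cas_cong_ends:
  assumes "tail G = tail H" "head G = head H"
  shows "pre_digraph.cas G u p v = pre_digraph.cas H u p v"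
  using assms by (induction p arbitrary: u) (auto simp: pre_digraph.cas.simps)

lemma awalk_verts_cong_ends:
  assumes "tail G = tail H" "head G = head H"
  shows "pre_digraph.awalk_verts G u p = pre_digraph.awalk_verts H u p"
  using assms by (simp add: pre_digraph.awalk_verts_conv)

lemma traversals_ends_cong:
  assumes "tail G = tail H" "head G = head H"
  shows "tail (traversals G) = tail (traversals H)" "head (traversals G) = head (traversals H)"
  unfolding traversals_def assms by simp_all

lemma undirected_cycle_iff:
  "undirected_cycle G p \<longleftrightarrow>
    (\<exists>u\<in>verts G. fst ` set p \<subseteq> arcs G \<and> pre_digraph.cas (traversals G) u p u \<and>
      distinct (tl (pre_digraph.awalk_verts (traversals G) u p)) \<and> p \<noteq> [] \<and> distinct (map fst p))"
proof -
  have "set p \<subseteq> arcs G \<times> UNIV \<longleftrightarrow> fst ` set p \<subseteq> arcs G"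
    by force
  then show ?thesis
    unfolding undirected_cycle_def pre_digraph.cycle_def pre_digraph.awalk_def by auto
qed

lemma undirected_cycle_arcs: "undirected_cycle G p \<Longrightarrow> fst ` set p \<subseteq> arcs G"
  unfolding undirected_cycle_iff by blast

lemma undirected_cycle_mono:
  assumes "undirected_cycle G p" "verts G \<subseteq> verts H" "arcs G \<subseteq> arcs H"
    and ends: "tail G = tail H" "head G = head H"
  shows "undirected_cycle H p"
  using assms(1-3) traversals_ends_cong[OF ends]
  unfolding undirected_cycle_iff
  by (metis (no_types, lifting) awalk_verts_cong_ends cas_cong_ends subset_iff)

text \<open>Each traversal contributes the potential at its end minus that at its start, so the sum
  telescopes.\<close>

lemma sum_potential_walk:
  fixes y :: "'v \<Rightarrow> real"
  assumes "pre_digraph.cas (traversals G) u p v"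
  shows "(\<Sum>(a, s)\<leftarrow>p. if s then y (head G a) - y (tail G a) else - (y (head G a) - y (tail G a)))
    = y v - y u"
  using assms by (induction p arbitrary: u) (auto simp: pre_digraph.cas.simps split: if_splits)

lemma sum_potential_undirected_cycle:
  fixes y :: "'v \<Rightarrow> real"
  assumes "undirected_cycle G p" "fst ` set p \<subseteq> A" "finite A"
  shows "(\<Sum>a\<in>A. (y (head G a) - y (tail G a)) * traversal_count p a) = 0"
proof -
  obtain u where "pre_digraph.cas (traversals G) u p u" "distinct (map fst p)"
    using assms(1) by (auto simp: undirected_cycle_iff)
  then show ?thesis
    using sum_potential_walk[of G u p u y] sum_traversal_count[of p A "\<lambda>a. y (head G a) - y (tail G a)"]
      assms(2,3)
    by simp
qed

text \<open>A cycle leaves each of its vertices by exactly one arc, so its arc set and first arc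
  determine the order of the arcs.\<close>

lemma cycle_unique:
  assumes p: "pre_digraph.cycle G p" and q: "pre_digraph.cycle G q" and wf: "wf_digraph G"
    and eq: "set p = set q" "hd p = hd q"
  shows "p = q"
proof -
  interpret wf_digraph G by fact
  obtain u where u: "awalk u p u" "distinct (tl (awalk_verts u p))" "distinct p" "p \<noteq> []"
    using p by (auto simp: cycle_conv)
  obtain v where v: "awalk v q v" "distinct q" "q \<noteq> []"
    using q by (auto simp: cycle_conv)
  have heads: "distinct (map (head G) p)"
    using u awalk_verts_conv'[of u p u] by auto
  have "map (tail G) p @ [head G (last p)] = u # map (head G) p"
    using u awalk_verts_conv[of u p] awalk_verts_conv'[of u p u] by (cases p) auto
  moreover have "head G (last p) = u"
    using u awalk_verts_conv[of u p] by (auto dest!: awlast_of_awalk[OF u(1)])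
  \<comment> \<open>Along a closed walk the tails are the heads shifted cyclically, so distinctness
    passes from heads to tails.\<close>
  ultimately have "mset (map (tail G) p) = mset (map (head G) p)"
    by (metis add_mset_add_single add_right_cancel mset.simps(1,2) mset_append)
  then have "distinct (map (tail G) p)"
    using heads mset_eq_imp_distinct_iff by blast
  then have inj: "inj_on (tail G) (set p)"
    by (simp add: distinct_map)
  \<comment> \<open>Injectivity of the tail on \<open>set p\<close> forces the next arc at every
    vertex.\<close>
  have unique: "p' = q'"
    if "cas x p' y" "cas x q' z" "set p' \<subseteq> set p" "set q' \<subseteq> set p" "length p' = length q'"
    for x y z p' q'
    using that
  proof (induction p' arbitrary: x q')
    case (Cons a p')
    then obtain b q'' where q': "q' = b # q''" by (cases q') auto
    with Cons.prems inj have "a = b"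
      by (auto dest: inj_onD)
    then show ?case
      using Cons q' by auto
  qed auto
  have "u = v"
    using u v eq(2) by (cases p; cases q) (auto simp: awalk_simps)
  moreover have "length p = length q"
    using u v eq(1) by (metis distinct_card)
  ultimately show ?thesis
    using unique[of u p u q u] u v eq(1) by auto
qed

text \<open>A path visits no vertex twice, and using an arrow again, in either direction, would
  return to the vertex it first left from.\<close>

lemma apath_traversals_distinct_arcs:
  assumes "wf_digraph G" "pre_digraph.apath (traversals G) u p v"
  shows "distinct (map fst p)"
proof -
  interpret wf_digraph "traversals G"
    using assms(1) by (rule wf_digraph_traversals)
  show ?thesis
    using assms(2)
  proof (induction p arbitrary: u)
    case (Cons x p)
    obtain a s where x: "x = (a, s)" by (cases x)
    have p: "apath (head (traversals G) x) p v"
      "tail (traversals G) x \<notin> set (awalk_verts (head (traversals G) x) p)"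
      using Cons.prems by (auto simp: apath_Cons_iff)
    have "(a, s') \<notin> set p" for s'
    proof
      assume "(a, s') \<in> set p"
      then have "{tail G a, head G a} \<subseteq> set (awalk_verts (head (traversals G) x) p)"
        using awalk_verts_arc1[of "(a, s')" p "head (traversals G) x"]
          awalk_verts_arc2[OF awalkI_apath[OF p(1)], of "(a, s')"]
        by (auto split: if_splits)
      then show False
        using p(2) by (auto simp: x split: if_splits)
    qed
    then show ?case
      using Cons.IH[OF p(1)] by (auto simp: x)
  qed auto
qed

text \<open>A simple path from the head of \<open>b\<close> back to its tail is closed up by
  \<open>b\<close>; the empty path covers the case of a loop.\<close>

lemma undirected_cycle_add_arc:
  assumes wf: "wf_digraph G" and b: "b \<notin> arcs G" "tail G b \<in> verts G"
    and reach: "head G b \<rightarrow>\<^sup>*\<^bsub>traversals G\<^esub> tail G b"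
  obtains p where "undirected_cycle (pre_digraph.add_arc G b) p" "hd p = (b, True)"
proof -
  interpret wf_digraph "traversals G"
    using wf by (rule wf_digraph_traversals)
  let ?G = "pre_digraph.add_arc G b"
  obtain p where p: "apath (head G b) p (tail G b)"
    using reach by (auto simp: reachable_apath)
  have ends: "tail (traversals ?G) = tail (traversals G)" "head (traversals ?G) = head (traversals G)"
    by (rule traversals_ends_cong; simp add: pre_digraph.add_arc_simps)+
  have "distinct (map fst p)"
    using apath_traversals_distinct_arcs[OF wf p] .
  moreover have "fst ` set p \<subseteq> arcs G"
    using p by (auto simp: apath_def awalk_def)
  ultimately have "undirected_cycle ?G ((b, True) # p)"
    unfolding undirected_cycle_iff using b p
    by (intro bexI[of _ "tail G b"])
      (auto simp: pre_digraph.add_arc_simps pre_digraph.verts_add_arc_conv cas_cong_ends[OF ends]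
        awalk_verts_cong_ends[OF ends] apath_def awalk_def)
  then show thesis
    by (rule that) simp
qed

text \<open>Arrows are added one at a time. In a forest a new arrow joins two distinct components,
  and shifting the potential on one of them gives the arrow its prescribed difference.\<close>

lemma forest_potential:
  fixes w :: "'e \<Rightarrow> real"
  assumes wf: "wf_digraph T" and fin: "finite (arcs T)" and forest: "\<And>p. \<not> undirected_cycle T p"
  obtains y where "\<And>a. a \<in> arcs T \<Longrightarrow> y (head T a) - y (tail T a) = w a"
proof -
  interpret T: wf_digraph T by fact
  have "\<exists>y. \<forall>a\<in>A. y (head T a) - y (tail T a) = w a" if "finite A" "A \<subseteq> arcs T" for A
    using that
  proof (induction A)
    case (insert e A)
    then obtain y where y: "\<And>a. a \<in> A \<Longrightarrow> y (head T a) - y (tail T a) = w a"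
      by auto
    define G where "G = T\<lparr>arcs := A\<rparr>"
    have G [simp]: "verts G = verts T" "arcs G = A" "tail G = tail T" "head G = head T"
      by (simp_all add: G_def)
    have e: "e \<in> arcs T" and A: "A \<subseteq> arcs T"
      using insert.prems by auto
    have wfG: "wf_digraph G"
      using A by (auto simp: wf_digraph_def)
    interpret R: wf_digraph "traversals G"
      using wfG by (rule wf_digraph_traversals)
    \<comment> \<open>\<open>C\<close> is the undirected component of the head of \<open>e\<close>
      before \<open>e\<close> is added; if it contained the tail, \<open>e\<close> would close a
      cycle.\<close>
    define C where "C = {v. head T e \<rightarrow>\<^sup>*\<^bsub>traversals G\<^esub> v}"
    have "tail T e \<notin> C"
    proof
      assume "tail T e \<in> C"
      then obtain p where "undirected_cycle (pre_digraph.add_arc G e) p"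
        using undirected_cycle_add_arc[OF wfG, of e] insert.hyps e by (auto simp: C_def)
      then have "undirected_cycle T p"
        by (rule undirected_cycle_mono)
          (use A e in \<open>auto simp: pre_digraph.add_arc_simps pre_digraph.verts_add_arc_conv\<close>)
      with forest show False by blast
    qed
    moreover have "head T e \<in> C"
      using e by (auto simp: C_def)
    moreover have "head T a \<in> C \<longleftrightarrow> tail T a \<in> C" if "a \<in> A" for a
      using R.in_arcs_imp_in_arcs_ends[of "(a, True)"] R.in_arcs_imp_in_arcs_ends[of "(a, False)"] that
      by (auto simp: C_def intro: R.reachable_adj_trans)
    \<comment> \<open>The shift on \<open>C\<close> is the defect of \<open>y\<close> at
      \<open>e\<close>. Arrows of \<open>A\<close> have both ends in \<open>C\<close> or neither, so
      their differences survive.\<close>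
    moreover define z where "z v = y v + (if v \<in> C then w e - (y (head T e) - y (tail T e)) else 0)" for v
    ultimately have "\<forall>a\<in>insert e A. z (head T a) - z (tail T a) = w a"
      using y by auto
    then show ?case by blast
  qed auto
  from this[OF fin subset_refl] show thesis
    by (auto intro: that)
qed

lemma connected_reachable_traversals:
  assumes "wf_digraph G" "Digraph_Component.connected G" "u \<in> verts G" "v \<in> verts G"
  shows "u \<rightarrow>\<^sup>*\<^bsub>traversals G\<^esub> v"
proof -
  interpret wf_digraph G by fact
  have "u \<rightarrow>\<^sup>*\<^bsub>with_proj (mk_symmetric G)\<^esub> v"
    using assms by (simp add: connected_def strongly_connected_def)
  moreover have "arcs_ends (with_proj (mk_symmetric G)) \<subseteq> arcs_ends (traversals G)"
  proof -
    have "{(tail G a, head G a), (head G a, tail G a)} \<subseteq> arcs_ends (traversals G)"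
      if "a \<in> arcs G" for a
      using that unfolding arcs_ends_def arc_to_ends_def
      by (auto intro: image_eqI[of _ _ "(a, True)"] image_eqI[of _ _ "(a, False)"])
    then show ?thesis
      by (auto simp: parcs_mk_symmetric)
  qed
  ultimately show ?thesis
    unfolding reachable_def by (auto intro: rtrancl_on_mono)
qed

section \<open>Fundamental cycles and circulations of a spanning tree\<close>

locale quiver_with_tree = fin_digraph Q for Q :: "('v, 'e) pre_digraph" +
  fixes T :: "('v, 'e) pre_digraph"
  assumes tree: "quiver_spanning_tree T Q"
begin

lemma tree_simps [simp]: "verts T = verts Q" "tail T = tail Q" "head T = head Q"
  and tree_arcs: "arcs T \<subseteq> arcs Q"
  and wf_tree: "wf_digraph T"
  and tree_forest: "\<not> undirected_cycle T p"
  using tree by (auto simp: quiver_spanning_tree_def spanning_def subgraph_def compatible_def)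

lemma finite_tree_arcs [simp]: "finite (arcs T)"
  using tree_arcs finite_arcs by (rule finite_subset)

lemma add_arc_tree [simp]:
  "tail (pre_digraph.add_arc T b) = tail Q" "head (pre_digraph.add_arc T b) = head Q"
  "arcs (pre_digraph.add_arc T b) = insert b (arcs T)"
  by (simp_all add: pre_digraph.add_arc_simps)

lemma wf_add_arc_tree: "b \<in> arcs Q \<Longrightarrow> wf_digraph (pre_digraph.add_arc T b)"
  using tree_arcs by (auto simp: wf_digraph_def pre_digraph.verts_add_arc_conv)

text \<open>A potential on the tree that jumps only across \<open>e\<close> determines how every cycle of
  \<open>T \<union> {b}\<close> through \<open>b\<close> traverses \<open>e\<close>.\<close>

lemma fundamental_cycle_unique:
  assumes b: "b \<in> arcs Q - arcs T"
    and p: "undirected_cycle (pre_digraph.add_arc T b) p" "hd p = (b, True)"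
    and q: "undirected_cycle (pre_digraph.add_arc T b) q" "hd q = (b, True)"
  shows "p = q"
proof -
  let ?G = "pre_digraph.add_arc T b"
  have support: "fst ` set r \<subseteq> insert b (arcs T)" if "undirected_cycle ?G r" for r
    using undirected_cycle_arcs[OF that] by simp
  have b1: "traversal_count r b = 1" if "undirected_cycle ?G r" "hd r = (b, True)" for r
    using that hd_in_set[of r] by (auto simp: traversal_count_def undirected_cycle_iff)
  have "traversal_count p e = traversal_count q e" for e
  proof (cases "e \<in> arcs T")
    case True
    obtain y where y: "\<And>a. a \<in> arcs T \<Longrightarrow> y (head T a) - y (tail T a) = (if a = e then 1 else 0 :: real)"
      using forest_potential[OF wf_tree _ tree_forest, of "\<lambda>a. if a = e then 1 else 0"] by auto
    \<comment> \<open>In the vanishing sum only \<open>e\<close> and \<open>b\<close> contribute,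
      and \<open>b\<close> has coefficient 1. So the coefficient at \<open>e\<close> does not depend
      on \<open>r\<close>.\<close>
    have "y (head Q b) - y (tail Q b) + traversal_count r e = 0"
      if "undirected_cycle ?G r" "hd r = (b, True)" for r
    proof -
      have "(\<Sum>a\<in>arcs T. (y (head T a) - y (tail T a)) * traversal_count r a) =
          (\<Sum>a\<in>arcs T. if a = e then real_of_int (traversal_count r a) else 0)"
        by (intro sum.cong) (simp_all add: y del: tree_simps)
      also have "\<dots> = traversal_count r e"
        using True by simp
      finally show ?thesis
        using sum_potential_undirected_cycle[OF that(1) support[OF that(1)], of y] b1[OF that] b
        by simp
    qed
    from this[OF p] this[OF q] show ?thesis by simp
  next
    case False
    then show ?thesis
    proof (cases "e = b")
      case True
      then show ?thesis using b1 p q by simp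
    next
      case neq: False
      with False have "e \<notin> fst ` set p" "e \<notin> fst ` set q"
        using support[OF p(1)] support[OF q(1)] by auto
      then have "(e, s) \<notin> set p" "(e, s) \<notin> set q" for s
        by (force simp: image_iff)+
      then show ?thesis by (simp add: traversal_count_def)
    qed
  qed
  \<comment> \<open>No arrow is traversed both ways, so the counts recover the set of
    traversals.\<close>
  moreover have "(a, s) \<in> set r \<longleftrightarrow> traversal_count r a = (if s then 1 else -1)"
    if "undirected_cycle ?G r" for r a s
  proof -
    have "inj_on fst (set r)"
      using that by (simp add: undirected_cycle_def distinct_map)
    then have "\<not> ((a, True) \<in> set r \<and> (a, False) \<in> set r)"
      by (auto dest: inj_onD[where x = "(a, True)" and y = "(a, False)"])
    then show ?thesis by (cases s) (auto simp: traversal_count_def)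
  qed
  ultimately have "x \<in> set p \<longleftrightarrow> x \<in> set q" for x
    using p(1) q(1) by (cases x) presburger
  then have "set p = set q"
    by blast
  moreover have "wf_digraph (traversals ?G)"
    using b by (intro wf_digraph_traversals wf_add_arc_tree) auto
  ultimately show ?thesis
    using p q cycle_unique[of "traversals ?G" p q] by (simp add: undirected_cycle_def)
qed

text \<open>Connectedness of \<open>T\<close> gives existence and the preceding lemma uniqueness, so
  the definite description denotes.\<close>

lemma fundamental_cycle:
  assumes b: "b \<in> arcs Q - arcs T"
  shows "undirected_cycle (pre_digraph.add_arc T b) (fundamental_cycle T b)"
    and "hd (fundamental_cycle T b) = (b, True)"
proof -
  have "Digraph_Component.connected T"
    using tree by (simp add: quiver_spanning_tree_def)
  then have reach: "head T b \<rightarrow>\<^sup>*\<^bsub>traversals T\<^esub> tail T b"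
    using b by (intro connected_reachable_traversals wf_tree) auto
  have "b \<notin> arcs T" "tail T b \<in> verts T"
    using b by auto
  from undirected_cycle_add_arc[OF wf_tree this reach]
  obtain p where p: "undirected_cycle (pre_digraph.add_arc T b) p \<and> hd p = (b, True)"
    by auto
  have "undirected_cycle (pre_digraph.add_arc T b) (fundamental_cycle T b) \<and>
      hd (fundamental_cycle T b) = (b, True)"
    unfolding fundamental_cycle_def
  proof (rule theI)
    show "undirected_cycle (pre_digraph.add_arc T b) p \<and> hd p = (b, True)"
      by (fact p)
  next
    fix q assume "undirected_cycle (pre_digraph.add_arc T b) q \<and> hd q = (b, True)"
    then show "q = p"
      using p by (intro fundamental_cycle_unique[OF b]) auto
  qed
  then show "undirected_cycle (pre_digraph.add_arc T b) (fundamental_cycle T b)"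
    and "hd (fundamental_cycle T b) = (b, True)" by auto
qed

lemma fundamental_cycle_support:
  assumes "b \<in> arcs Q - arcs T"
  shows "fst ` set (fundamental_cycle T b) \<subseteq> insert b (arcs T)"
  using undirected_cycle_arcs[OF fundamental_cycle(1)[OF assms]] by simp

lemma circulation_self: "b \<in> arcs Q - arcs T \<Longrightarrow> circulation T b b = 1"
  using fundamental_cycle[of b] hd_in_set[of "fundamental_cycle T b"]
  by (auto simp: circulation_def undirected_cycle_iff)

text \<open>With \<open>circulation_self\<close>: restricted to the arrows outside \<open>T\<close>,
  the circulations are the unit vectors.\<close>

lemma circulation_outside:
  "b \<in> arcs Q - arcs T \<Longrightarrow> a \<notin> insert b (arcs T) \<Longrightarrow> circulation T b a = 0"
  using fundamental_cycle_support[of b] by (auto simp: circulation_def rev_image_eqI subset_iff image_iff)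

lemma sum_potential_circulation:
  fixes y :: "'v \<Rightarrow> real"
  assumes "b \<in> arcs Q - arcs T"
  shows "(\<Sum>a\<in>arcs Q. (y (head Q a) - y (tail Q a)) * circulation T b a) = 0"
  using sum_potential_undirected_cycle[OF fundamental_cycle(1)[OF assms], of "arcs Q" y]
    fundamental_cycle_support[OF assms] tree_arcs assms
  by (auto simp: circulation_eq)

text \<open>A potential is fitted to \<open>w\<close> on the tree. The defect \<open>d\<close>
  vanishes there and stays orthogonal to each circulation, whose only arrow outside \<open>T\<close>
  is \<open>b\<close> with coefficient 1; hence \<open>d b = 0\<close>.\<close>

lemma orthogonal_imp_potential:
  fixes w :: "'e \<Rightarrow> real"
  assumes orth: "\<And>b. b \<in> arcs Q - arcs T \<Longrightarrow> (\<Sum>a\<in>arcs Q. w a * circulation T b a) = 0"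
  obtains y where "\<And>a. a \<in> arcs Q \<Longrightarrow> w a = y (head Q a) - y (tail Q a)"
proof -
  obtain y where y: "\<And>a. a \<in> arcs T \<Longrightarrow> y (head T a) - y (tail T a) = w a"
    using forest_potential[OF wf_tree _ tree_forest] by auto
  define d where "d a = w a - (y (head Q a) - y (tail Q a))" for a
  have d_tree: "d a = 0" if "a \<in> arcs T" for a
    using y[OF that] by (simp add: d_def)
  have "d b = 0" if b: "b \<in> arcs Q - arcs T" for b
  proof -
    have "0 = (\<Sum>a\<in>arcs Q. d a * circulation T b a)"
      using orth[OF b] sum_potential_circulation[OF b, of y]
      by (simp add: d_def left_diff_distrib[where b = "y _ - y _"] sum_subtractf)
    also have "\<dots> = (\<Sum>a\<in>{b}. d a * circulation T b a)"
      using b d_tree circulation_outside[OF b] by (intro sum.mono_neutral_right) auto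
    finally show ?thesis
      using circulation_self[OF b] by simp
  qed
  then have "d a = 0" if "a \<in> arcs Q" for a
    using d_tree that by blast
  then show thesis
    by (intro that[of y]) (simp add: d_def)
qed

end

section \<open>Incidence and stability\<close>

context fin_digraph
begin

text \<open>Summation by parts: \<open>incidence\<close> is adjoint to taking potential
  differences.\<close>

lemma sum_incidence:
  fixes y :: "'a \<Rightarrow> real"
  shows "(\<Sum>v\<in>verts G. y v * incidence G x v) = (\<Sum>a\<in>arcs G. (y (head G a) - y (tail G a)) * x a)"
proof -
  have *: "(\<Sum>v\<in>verts G. \<Sum>a\<in>{a \<in> arcs G. g a = v}. y v * x a) = (\<Sum>a\<in>arcs G. y (g a) * x a)"
    if "g ` arcs G \<subseteq> verts G" for g
  proof -
    have "(\<Sum>v\<in>verts G. \<Sum>a\<in>{a \<in> arcs G. g a = v}. y v * x a) =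
        (\<Sum>v\<in>verts G. \<Sum>a\<in>{a \<in> arcs G. g a = v}. y (g a) * x a)"
      by (intro sum.cong) auto
    also have "\<dots> = (\<Sum>a\<in>arcs G. y (g a) * x a)"
      using that by (intro sum.group) auto
    finally show ?thesis .
  qed
  show ?thesis
    using *[OF image_subsetI[OF head_in_verts]] *[OF image_subsetI[OF tail_in_verts]]
    by (simp add: incidence_def in_arcs_def out_arcs_def right_diff_distrib left_diff_distrib
        sum_subtractf sum_distrib_left)
qed

lemma sum_canonical_weight:
  fixes y :: "'a \<Rightarrow> real"
  shows "(\<Sum>v\<in>verts G. y v * canonical_weight G v) = (\<Sum>a\<in>arcs G. y (head G a) - y (tail G a))"
  unfolding canonical_weight_def sum_incidence by (intro sum.cong) auto

lemma incidence_eq_0_iff: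
  "(\<forall>v\<in>verts G. incidence G x v = 0) \<longleftrightarrow>
    (\<forall>y. (\<Sum>a\<in>arcs G. (y (head G a) - y (tail G a)) * x a) = 0)"
proof
  assume *: "\<forall>y. (\<Sum>a\<in>arcs G. (y (head G a) - y (tail G a)) * x a) = 0"
  show "\<forall>v\<in>verts G. incidence G x v = 0"
  proof
    fix v assume "v \<in> verts G"
    \<comment> \<open>The indicator of \<open>v\<close> as potential isolates the condition at
      \<open>v\<close>.\<close>
    moreover have "(\<Sum>u\<in>verts G. (if u = v then 1 else 0) * incidence G x u) = 0"
      unfolding sum_incidence using *[rule_format, of "\<lambda>u. if u = v then 1 else 0"] .
    ultimately show "incidence G x v = 0"
      by (simp add: if_distrib[where f = "\<lambda>c. c * _"] cong: if_cong)
  qed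
qed (simp flip: sum_incidence)

text \<open>The height of a vertex is the number of vertices that reach it. It grows strictly along
  \<open>a\<close>, since the head reaches itself but, by acyclicity, not the tail.\<close>

lemma acyclic_height:
  assumes acyclic: "\<not> (\<exists>p. cycle p)"
  obtains h :: "'a \<Rightarrow> real" where "\<And>a. a \<in> arcs G \<Longrightarrow> h (tail G a) < h (head G a)"
proof
  fix a assume a: "a \<in> arcs G"
  let ?R = "\<lambda>v. {u \<in> verts G. u \<rightarrow>\<^sup>* v}"
  have "\<not> head G a \<rightarrow>\<^sup>* tail G a"
  proof
    assume "head G a \<rightarrow>\<^sup>* tail G a"
    then obtain p where "awalk (head G a) p (tail G a)"
      by (auto simp: reachable_awalk)
    then have "closed_w (a # p)"
      using a by (auto simp: closed_w_def awalk_Cons_iff)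
    then show False
      using acyclic closed_w_imp_cycle by blast
  qed
  then have "head G a \<in> ?R (head G a) - ?R (tail G a)"
    using a by auto
  moreover have "?R (tail G a) \<subseteq> ?R (head G a)"
    using in_arcs_imp_in_arcs_ends[OF a] by (auto intro: reachable_adj_trans)
  ultimately have "?R (tail G a) \<subset> ?R (head G a)"
    by blast
  then show "real (card (?R (tail G a))) < real (card (?R (head G a)))"
    by (simp add: psubset_card_mono)
qed

end

text \<open>Peeling off the lowest positive level set writes \<open>y\<close> as a positive combination of
  indicators of its superlevel sets.\<close>

lemma sum_superlevel_pos:
  fixes y \<theta> :: "'v \<Rightarrow> real"
  assumes "finite V" "\<And>v. v \<in> V \<Longrightarrow> 0 \<le> y v" "{v \<in> V. 0 < y v} \<noteq> {}"
    and "\<And>t. 0 < t \<Longrightarrow> {v \<in> V. t \<le> y v} \<noteq> {} \<Longrightarrow> 0 < (\<Sum>v\<in>{v \<in> V. t \<le> y v}. \<theta> v)"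
  shows "0 < (\<Sum>v\<in>V. y v * \<theta> v)"
  using assms(2-)
proof (induction "card {v \<in> V. 0 < y v}" arbitrary: y rule: less_induct)
  case less
  let ?V = "{v \<in> V. 0 < y v}"
  define m where "m = Min (y ` ?V)"
  have fin: "finite ?V" using assms(1) by simp
  have "m \<in> y ` ?V"
    unfolding m_def using fin less.prems(2) by (intro Min_in) auto
  then obtain v0 where v0: "v0 \<in> ?V" "y v0 = m" by auto
  have m: "m \<le> y v" if "v \<in> ?V" for v
    unfolding m_def using fin that by (intro Min_le) auto
  have "0 < m" using v0 by auto
  have V_eq: "?V = {v \<in> V. m \<le> y v}"
    using m \<open>0 < m\<close> by fastforce
  \<comment> \<open>\<open>m\<close> is the least positive value of \<open>y\<close> on
    \<open>V\<close>. Lowering \<open>y\<close> by \<open>m\<close> on its positive set makes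
    \<open>z\<close> vanish at \<open>v0\<close>, so that set shrinks.\<close>
  define z where "z v = (if m \<le> y v then y v - m else y v)" for v
  have z_le: "z v \<le> 0" if "v \<in> V" "v \<notin> ?V" for v
    using that \<open>0 < m\<close> by (auto simp: z_def)
  have z_nonneg: "0 \<le> z v" if "v \<in> V" for v
    using that less.prems(1) by (auto simp: z_def)
  have level: "{v \<in> V. t \<le> z v} = {v \<in> V. t + m \<le> y v}" if "0 < t" for t
    using that \<open>0 < m\<close> m by (auto simp: z_def)
  \<comment> \<open>Only a weak bound, as \<open>z\<close> may vanish on all of \<open>V\<close>;
    strictness comes from the level set that was peeled off.\<close>
  have "0 \<le> (\<Sum>v\<in>V. z v * \<theta> v)"
  proof (cases "{v \<in> V. 0 < z v} = {}")
    case True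
    then have "z v = 0" if "v \<in> V" for v
      using z_nonneg[OF that] that by force
    then show ?thesis by simp
  next
    case False
    have "{v \<in> V. 0 < z v} \<subset> ?V"
      using z_le v0 by (force simp: z_def)
    then have "card {v \<in> V. 0 < z v} < card ?V"
      using fin by (rule psubset_card_mono[rotated])
    then have "0 < (\<Sum>v\<in>V. z v * \<theta> v)"
      using z_nonneg False less.prems(3) level \<open>0 < m\<close> by (intro less.hyps) auto
    then show ?thesis by simp
  qed
  moreover have "0 < m * (\<Sum>v\<in>?V. \<theta> v)"
    using less.prems(3)[OF \<open>0 < m\<close>] less.prems(2) \<open>0 < m\<close> by (simp add: V_eq)
  moreover have "(\<Sum>v\<in>V. y v * \<theta> v) = (\<Sum>v\<in>V. z v * \<theta> v) + m * (\<Sum>v\<in>?V. \<theta> v)"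
  proof -
    have "(\<Sum>v\<in>?V. \<theta> v) = (\<Sum>v\<in>V. if m \<le> y v then \<theta> v else 0)"
      unfolding V_eq using assms(1) by (rule sum.inter_filter)
    then show ?thesis
      by (auto simp: sum_distrib_left z_def algebra_simps simp flip: sum.distrib intro!: sum.cong)
  qed
  ultimately show ?case by linarith
qed

text \<open>Subtracting the minimum of \<open>y\<close> leaves the sum unchanged because the total
  weight is 0. Monotonicity makes the superlevel sets successor closed, so stability applies to
  them.\<close>

lemma stable_sum_pos:
  fixes y \<theta> :: "'v \<Rightarrow> real"
  assumes "stable G \<theta>" "finite (verts G)" "wf_digraph G" "(\<Sum>v\<in>verts G. \<theta> v) = 0"
    and mono: "\<And>a. a \<in> arcs G \<Longrightarrow> y (tail G a) \<le> y (head G a)"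
    and uv: "u \<in> verts G" "v \<in> verts G" "y u < y v"
  shows "0 < (\<Sum>v\<in>verts G. y v * \<theta> v)"
proof -
  interpret wf_digraph G by fact
  define m where "m = Min (y ` verts G)"
  have m: "m \<le> y x" if "x \<in> verts G" for x
    unfolding m_def using assms(2) that by (intro Min_le) auto
  obtain x0 where x0: "x0 \<in> verts G" "y x0 = m"
    unfolding m_def using Min_in[of "y ` verts G"] assms(2) uv by fastforce
  have "0 < (\<Sum>v\<in>verts G. (y v - m) * \<theta> v)"
  proof (rule sum_superlevel_pos)
    fix t :: real
    let ?V = "{x \<in> verts G. t \<le> y x - m}"
    assume "0 < t" "?V \<noteq> {}"
    moreover have "successor_closed G ?V"
      using mono by (fastforce simp: successor_closed_def)
    \<comment> \<open>The minimiser lies outside every superlevel set with positive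
      \<open>t\<close>, which makes these sets proper.\<close>
    moreover have "x0 \<notin> ?V"
      using x0 \<open>0 < t\<close> by auto
    ultimately show "0 < (\<Sum>v\<in>?V. \<theta> v)"
      using assms(1) x0(1) unfolding stable_def by metis
  next
    show "{x \<in> verts G. 0 < y x - m} \<noteq> {}"
      using uv m by force
  qed (use assms(2) m in auto)
  also have "\<dots> = (\<Sum>v\<in>verts G. y v * \<theta> v) - m * (\<Sum>v\<in>verts G. \<theta> v)"
    by (simp add: left_diff_distrib sum_subtractf sum_distrib_left)
  finally show ?thesis
    using assms(4) by simp
qed

section \<open>The polar dual\<close>

text \<open>The bipolar theorem for a finite set: a point outside the closed hull is strictly
  separated from it.\<close>

lemma bipolar_finite:
  fixes U :: "'a::euclidean_space set"
  assumes "finite U" "0 \<in> convex hull U"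
  shows "{c. \<forall>x. (\<forall>u\<in>U. u \<bullet> x \<le> 1) \<longrightarrow> c \<bullet> x \<le> 1} = convex hull U"
proof (intro equalityI subsetI)
  fix c assume c: "c \<in> {c. \<forall>x. (\<forall>u\<in>U. u \<bullet> x \<le> 1) \<longrightarrow> c \<bullet> x \<le> 1}"
  show "c \<in> convex hull U"
  proof (rule ccontr)
    assume "c \<notin> convex hull U"
    moreover have "closed (convex hull U)"
      using assms(1) by (simp add: compact_imp_closed finite_imp_compact_convex_hull)
    ultimately obtain n r where n: "n \<bullet> c < r" "\<And>u. u \<in> convex hull U \<Longrightarrow> r < n \<bullet> u"
      using separating_hyperplane_closed_point[of "convex hull U" c] by auto
    have "r < 0"
      using n(2)[OF assms(2)] by simp
    \<comment> \<open>As 0 lies in the hull, \<open>r\<close> is negative. Rescaling by its inverse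
      reverses the separating inequalities and moves the threshold to 1.\<close>
    have "u \<bullet> (n /\<^sub>R r) \<le> 1" if "u \<in> U" for u
      using n(2)[OF hull_inc[OF that]] \<open>r < 0\<close> by (simp add: inner_commute field_simps)
    then have "c \<bullet> (n /\<^sub>R r) \<le> 1"
      using c by blast
    moreover have "1 < c \<bullet> (n /\<^sub>R r)"
      using n(1) \<open>r < 0\<close> by (simp add: inner_commute field_simps)
    ultimately show False
      by simp
  qed
next
  fix c assume c: "c \<in> convex hull U"
  show "c \<in> {c. \<forall>x. (\<forall>u\<in>U. u \<bullet> x \<le> 1) \<longrightarrow> c \<bullet> x \<le> 1}"
  proof (intro CollectI allI impI)
    fix x assume "\<forall>u\<in>U. u \<bullet> x \<le> 1"
    then have "convex hull U \<subseteq> {c. x \<bullet> c \<le> 1}"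
      by (intro hull_minimal convex_halfspace_le) (auto simp: inner_commute)
    then show "c \<bullet> x \<le> 1"
      using c by (auto simp: inner_commute)
  qed
qed

lemma inner_dual_point:
  "dual_point T b a \<bullet> x = - circulation_combination T b x a"
  by (simp add: dual_point_def circulation_combination_def inner_vec_def sum_negf mult.commute)

section \<open>Linear relations among the dual points\<close>

locale quiver_with_cotree = quiver_with_tree Q T for Q T :: "('v, 'e) pre_digraph" +
  fixes b :: "'d::finite \<Rightarrow> 'e"
  assumes cotree: "bij_betw b UNIV (arcs Q - arcs T)"
begin

lemma cotree_arc: "b j \<in> arcs Q - arcs T"
  using cotree by (auto simp: bij_betw_def)

lemma sum_potential_dual_point:
  fixes y :: "'v \<Rightarrow> real"
  shows "(\<Sum>a\<in>arcs Q. (y (head Q a) - y (tail Q a)) *\<^sub>R dual_point T b a) = 0"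
  using sum_potential_circulation[OF cotree_arc, of y]
  by (simp add: vec_eq_iff dual_point_def sum_negf)

lemma orthogonal_dual_point_imp_potential:
  assumes "(\<Sum>a\<in>arcs Q. w a *\<^sub>R dual_point T b a) = 0"
  obtains y where "\<And>a. a \<in> arcs Q \<Longrightarrow> w a = y (head Q a) - y (tail Q a)"
proof (rule orthogonal_imp_potential)
  fix c assume "c \<in> arcs Q - arcs T"
  then obtain j where "c = b j"
    using cotree by (auto simp: bij_betw_def)
  then show "(\<Sum>a\<in>arcs Q. w a * circulation T c a) = 0"
    using assms by (simp add: vec_eq_iff dual_point_def sum_negf)
qed (erule that)

lemma incidence_circulation_combination:
  assumes "v \<in> verts Q"
  shows "incidence Q (circulation_combination T b x) v = 0"
proof -
  have "(\<Sum>a\<in>arcs Q. (y (head Q a) - y (tail Q a)) * circulation_combination T b x a) = 0"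
    for y :: "'v \<Rightarrow> real"
  proof -
    have "(\<Sum>a\<in>arcs Q. (y (head Q a) - y (tail Q a)) * circulation_combination T b x a)
        = - ((\<Sum>a\<in>arcs Q. (y (head Q a) - y (tail Q a)) *\<^sub>R dual_point T b a) \<bullet> x)"
      by (simp add: inner_sum_left inner_dual_point sum_negf)
    then show ?thesis
      by (simp add: sum_potential_dual_point)
  qed
  then show ?thesis
    using assms incidence_eq_0_iff by blast
qed

text \<open>Support and incidence conditions hold automatically for a combination of circulations.
  What remains is that its entries are at least -1, so the polar dual is the bipolar of the dual
  points.\<close>

lemma circulation_combination_in_shifted_iff:
  "circulation_combination T b x \<in> shifted_flow_polytope Q (canonical_weight Q) \<longleftrightarrow>
    (\<forall>a\<in>arcs Q. dual_point T b a \<bullet> x \<le> 1)"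
proof -
  let ?f = "circulation_combination T b x"
  let ?g = "\<lambda>a. ?f a + indicator (arcs Q) a"
  have "?f \<in> shifted_flow_polytope Q (canonical_weight Q) \<longleftrightarrow> ?g \<in> flow_polytope Q (canonical_weight Q)"
    unfolding shifted_flow_polytope_def by (auto intro!: image_eqI[of _ _ ?g])
  moreover have "?f a = 0" if "a \<notin> arcs Q" for a
  proof -
    have "circulation T (b j) a = 0" for j
      using that cotree_arc tree_arcs by (intro circulation_outside) auto
    then show ?thesis by (simp add: circulation_combination_def)
  qed
  moreover have "incidence Q ?g v = canonical_weight Q v" if "v \<in> verts Q" for v
    using incidence_circulation_combination[OF that, of x]
    by (simp add: incidence_def canonical_weight_def sum.distrib)
  ultimately show ?thesis
    by (fastforce simp: flow_polytope_def inner_dual_point)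
qed

lemma zero_in_hull_dual_points:
  assumes "\<not> (\<exists>p. cycle p)"
  shows "0 \<in> convex hull (dual_point T b ` arcs Q)"
proof -
  obtain h :: "'v \<Rightarrow> real" where h: "\<And>a. a \<in> arcs Q \<Longrightarrow> h (tail Q a) < h (head Q a)"
    using acyclic_height[OF assms] by blast
  let ?d = "\<lambda>a. h (head Q a) - h (tail Q a)"
  define s where "s = (\<Sum>a\<in>arcs Q. ?d a)"
  \<comment> \<open>The index type \<open>'d\<close> is inhabited, so some arrow lies outside
    \<open>T\<close>; hence the normalising sum \<open>s\<close> is positive.\<close>
  have "arcs Q \<noteq> {}" using cotree_arc by auto
  then have "0 < s"
    unfolding s_def using h by (intro sum_pos) auto
  have "(\<Sum>a\<in>arcs Q. (?d a / s) *\<^sub>R dual_point T b a) \<in> convex hull (dual_point T b ` arcs Q)"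
    using h \<open>0 < s\<close>
    by (intro convex_sum) (auto simp: less_imp_le hull_inc s_def simp flip: sum_divide_distrib)
  moreover have "(\<Sum>a\<in>arcs Q. (?d a / s) *\<^sub>R dual_point T b a) =
      (1 / s) *\<^sub>R (\<Sum>a\<in>arcs Q. ?d a *\<^sub>R dual_point T b a)"
    by (simp add: scaleR_sum_right)
  ultimately show ?thesis
    by (simp add: sum_potential_dual_point)
qed

lemma polar_dual_eq:
  assumes "\<not> (\<exists>p. cycle p)"
  shows "polar_dual Q (canonical_weight Q) T b = convex hull (dual_point T b ` arcs Q)"
  using bipolar_finite[OF _ zero_in_hull_dual_points[OF assms]]
  unfolding polar_dual_def circulation_combination_in_shifted_iff by simp

lemma dual_point_extreme:
  assumes tight: "tight Q (canonical_weight Q)" and a: "a \<in> arcs Q"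
  shows "dual_point T b a extreme_point_of convex hull (dual_point T b ` arcs Q)"
proof -
  let ?u = "dual_point T b"
  \<comment> \<open>The point is removed rather than the arrow, since distinct arrows might share a
    dual point.\<close>
  define S where "S = ?u ` arcs Q - {?u a}"
  have "?u a \<notin> convex hull S"
  proof
    assume hull: "?u a \<in> convex hull S"
    have "S \<subseteq> ?u ` arcs Q" by (auto simp: S_def)
    \<comment> \<open>One arrow is chosen for each point of \<open>S\<close>, so that convex weights
      on points become weights on arrows.\<close>
    then obtain C where C: "C \<subseteq> arcs Q" "inj_on ?u C" "S = ?u ` C"
      unfolding subset_image_inj by blast
    have fin: "finite C" using C(1) finite_arcs by (rule finite_subset)
    have "a \<notin> C" using C(3) by (auto simp: S_def)
    obtain \<mu> where \<mu>: "\<And>x. x \<in> S \<Longrightarrow> 0 \<le> \<mu> x" "sum \<mu> S = 1" "(\<Sum>x\<in>S. \<mu> x *\<^sub>R x) = ?u a"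
      using hull fin by (auto simp: C(3) convex_hull_finite)
    \<comment> \<open>The convex combination minus \<open>?u a\<close>, read as a linear relation:
      its only negative coefficient is -1 at \<open>a\<close>.\<close>
    define w where "w c = (if c \<in> C then \<mu> (?u c) else 0) - (if c = a then 1 else 0)" for c
    have "(\<Sum>c\<in>arcs Q. w c *\<^sub>R ?u c) = (\<Sum>c\<in>C. \<mu> (?u c) *\<^sub>R ?u c) - ?u a"
      using C(1) a
      by (simp add: w_def scaleR_diff_left sum_subtractf if_distrib[where f = "\<lambda>r. r *\<^sub>R _"]
          Int_absorb1 flip: sum.inter_restrict cong: if_cong)
    also have "\<dots> = 0"
      using \<mu>(3) C by (simp add: sum.reindex)
    finally obtain y where y: "\<And>c. c \<in> arcs Q \<Longrightarrow> w c = y (head Q c) - y (tail Q c)"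
      by (rule orthogonal_dual_point_imp_potential) blast
    have "0 < (\<Sum>v\<in>verts (del_arc a). y v * canonical_weight Q v)"
    proof (rule stable_sum_pos)
      show "stable (del_arc a) (canonical_weight Q)"
        using tight a by (simp add: tight_def)
      show "wf_digraph (del_arc a)"
        by (rule wf_digraph_del_arc)
      \<comment> \<open>A constant potential has zero differences.\<close>
      show "(\<Sum>v\<in>verts (del_arc a). canonical_weight Q v) = 0"
        using sum_canonical_weight[of "\<lambda>_. 1"] by simp
      show "y (tail (del_arc a) c) \<le> y (head (del_arc a) c)" if "c \<in> arcs (del_arc a)" for c
        using that y[of c] \<mu>(1)[of "?u c"] C(3) by (auto simp: w_def split: if_splits)
      show "y (head Q a) < y (tail Q a)"
        using y[OF a] \<open>a \<notin> C\<close> by (simp add: w_def)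
    qed (use a in auto)
    also have "(\<Sum>v\<in>verts (del_arc a). y v * canonical_weight Q v) = (\<Sum>c\<in>arcs Q. w c)"
      using y by (simp add: sum_canonical_weight)
    also have "\<dots> = (\<Sum>c\<in>C. \<mu> (?u c)) - 1"
      using C(1) a
      by (simp add: w_def sum_subtractf Int_absorb1 flip: sum.inter_restrict)
    also have "\<dots> = 0"
      using \<mu>(2) C by (simp add: sum.reindex)
    finally show False by simp
  qed
  \<comment> \<open>A point outside the hull of the finitely many others is extreme in the joint
    hull.\<close>
  then have "?u a extreme_point_of convex hull (insert (?u a) S)"
    by (intro extreme_point_of_convex_hull_insert) (simp_all add: S_def)
  then show ?thesis
    using a by (simp add: S_def insert_absorb)
qed

end

theorem theorem3p4:
  fixes Q T :: "('v, 'e) pre_digraph" and b :: "'d::finite \<Rightarrow> 'e"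
  assumes "fin_digraph Q"
    and "Digraph_Component.connected Q"
    and "\<not> (\<exists>p. pre_digraph.cycle Q p)"
    and "tight Q (canonical_weight Q)"
    and "quiver_spanning_tree T Q"
    and "bij_betw b UNIV (arcs Q - arcs T)"
  shows "polar_dual Q (canonical_weight Q) T b = convex hull {dual_point T b a | a. a \<in> arcs Q} \<and>
    (\<forall>a\<in>arcs Q. dual_point T b a extreme_point_of polar_dual Q (canonical_weight Q) T b)"
proof -
  interpret quiver_with_cotree Q T b
    using assms(1,5,6)
    by (simp add: quiver_with_cotree_def quiver_with_tree_def quiver_with_tree_axioms_def
        quiver_with_cotree_axioms_def)
  show ?thesis
    using polar_dual_eq[OF assms(3)] dual_point_extreme[OF assms(4)]
    by (simp add: Setcompr_eq_image)
qed

end
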